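(* Let $G$ be a finite simple undirected graph with $n$ vertices and $m$ edges, having Laplacian spectrum $\mu_i$ and signless Laplacian spectrum $\mu_i^+$, $1\le i\le n$, and let $k\ge 1$. Then the Laplacian spectrum of the $k$-th iterated extended double cover $G^{k*}$ is the multiset consisting, for each $1\le i\le n$, of: $\mu_i$ ($\binom{k}{0}$ times); for each $1\le r\le k-1$, $\mu_i+2r$ ($\binom{k-1}{r}$ times) and $\mu_i^++2r$ ($\binom{k-1}{r-1}$ times); and $\mu_i^++2k$ ($\binom{k}{k}$ times).
   Context: For a graph $G$ with adjacency matrix $A$ and diagonal degree matrix $D$, the Laplacian spectrum is the multiset of eigenvalues of $D-A$ and the signless Laplacian spectrum is the multiset of eigenvalues of $D+A$. For $G$ with vertex set $\{v_1,\dots,v_n\}$, the extended double cover $G^*$ is the bipartite graph with parts $X=\{x_1,\dots,x_n\}$, $Y=\{y_1,\dots,y_n\}$, where $x_i$ is adjacent to $y_j$ iff $i=j$ or $v_i$ is adjacent to $v_j$ in $G$. The $k$-th iterated extended double cover is defined by $G^{1*}=G^*$ and $G^{k*}=(G^{(k-1)*})^*$. *)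

theory Defs
  imports
    "Graph_Theory.Pair_Digraph"
    "Jordan_Normal_Form.Char_Poly"
    "HOL-Computational_Algebra.Computational_Algebra"
begin

text \<open>
  A finite simple undirected graph is a symmetric, loop-free digraph without parallel arcs
  (\<^locale>\<open>pair_graph\<close>): an edge between \<open>u\<close> and \<open>v\<close> is represented by the two arcs \<open>(u, v)\<close>
  and \<open>(v, u)\<close>. Hence the degree of a vertex is its out-degree.
\<close>

definition edges :: "'a pair_pre_digraph \<Rightarrow> 'a set set" where
  "edges G = {{u, v} | u v. (u, v) \<in> parcs G}"

text \<open>The matrices are written with respect to an enumeration \<open>vs\<close> of the vertices.\<close>

definition adjacency_mat :: "'a pair_pre_digraph \<Rightarrow> 'a list \<Rightarrow> complex mat" where
  "adjacency_mat G vs = mat (length vs) (length vs)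
     (\<lambda>(i, j). if (vs ! i, vs ! j) \<in> parcs G then 1 else 0)"

definition degree_mat :: "'a pair_pre_digraph \<Rightarrow> 'a list \<Rightarrow> complex mat" where
  "degree_mat G vs = mat_diag (length vs) (\<lambda>i. of_nat (out_degree (with_proj G) (vs ! i)))"

definition laplacian_mat :: "'a pair_pre_digraph \<Rightarrow> 'a list \<Rightarrow> complex mat" where
  "laplacian_mat G vs = degree_mat G vs - adjacency_mat G vs"

definition signless_laplacian_mat :: "'a pair_pre_digraph \<Rightarrow> 'a list \<Rightarrow> complex mat" where
  "signless_laplacian_mat G vs = degree_mat G vs + adjacency_mat G vs"

text \<open>
  Eigenvalues with their algebraic multiplicities, taken over the complex numbers, so that a
  matrix of dimension \<open>n\<close> has exactly \<open>n\<close> of them. For the real symmetric matrices above they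
  are real and the algebraic multiplicity is the dimension of the eigenspace.
\<close>

definition eigenvalue_mset :: "complex mat \<Rightarrow> complex multiset" where
  "eigenvalue_mset A = proots (char_poly A)"

definition vertex_list :: "'a pair_pre_digraph \<Rightarrow> 'a list" where
  "vertex_list G = (SOME vs. distinct vs \<and> set vs = pverts G)"

text \<open>
  The spectra do not depend on the enumeration of the vertices that is picked here; see
  \<open>laplacian_spectrum_eq\<close> and \<open>signless_laplacian_spectrum_eq\<close> below.
\<close>

definition laplacian_spectrum :: "'a pair_pre_digraph \<Rightarrow> complex multiset" where
  "laplacian_spectrum G = eigenvalue_mset (laplacian_mat G (vertex_list G))"

definition signless_laplacian_spectrum :: "'a pair_pre_digraph \<Rightarrow> complex multiset" where
  "signless_laplacian_spectrum G = eigenvalue_mset (signless_laplacian_mat G (vertex_list G))"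

text \<open>
  The double cover of a graph has two copies of each vertex. For the iteration to stay within
  one type, all vertices live in the type of terms built from the original vertices by the two
  copying operations \<open>v\<^sub>i \<mapsto> x\<^sub>i\<close> and \<open>v\<^sub>i \<mapsto> y\<^sub>i\<close>.
\<close>

datatype 'a cover_vertex =
  Base 'a | X_copy "'a cover_vertex" | Y_copy "'a cover_vertex"

definition base_graph :: "'a pair_pre_digraph \<Rightarrow> 'a cover_vertex pair_pre_digraph" where
  "base_graph G = \<lparr> pverts = Base ` pverts G, parcs = map_prod Base Base ` parcs G \<rparr>"

definition extended_double_cover ::
  "'a cover_vertex pair_pre_digraph \<Rightarrow> 'a cover_vertex pair_pre_digraph" where
  "extended_double_cover G =
     \<lparr> pverts = X_copy ` pverts G \<union> Y_copy ` pverts G,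
       parcs =
         {(X_copy u, Y_copy v) | u v.
            u \<in> pverts G \<and> v \<in> pverts G \<and> (u = v \<or> (u, v) \<in> parcs G)} \<union>
         {(Y_copy v, X_copy u) | u v.
            u \<in> pverts G \<and> v \<in> pverts G \<and> (u = v \<or> (u, v) \<in> parcs G)} \<rparr>"

text \<open>
  The iteration starts at \<open>0\<close> with (a copy of) the graph itself, so its first member is the
  extended double cover.
\<close>

primrec iterated_double_cover ::
  "nat \<Rightarrow> 'a pair_pre_digraph \<Rightarrow> 'a cover_vertex pair_pre_digraph" where
  "iterated_double_cover 0 G = base_graph G"
| "iterated_double_cover (Suc k) G = extended_double_cover (iterated_double_cover k G)"

lemma pair_graph_base_graph:
  assumes "pair_graph G"
  shows "pair_graph (base_graph G)"
proof -
  interpret pair_graph G by fact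
  show ?thesis
    using pair_sym_arcs
    by unfold_locales
      (auto simp: base_graph_def symmetric_def dest: in_arcsD1 in_arcsD2 no_loops'
        intro!: symI dest: symD)
qed

lemma pair_graph_extended_double_cover:
  assumes "pair_graph G"
  shows "pair_graph (extended_double_cover G)"
proof -
  interpret pair_graph G by fact
  have fin: "finite (pverts (extended_double_cover G))"
    by (simp add: extended_double_cover_def)
  moreover have "parcs (extended_double_cover G) \<subseteq>
      pverts (extended_double_cover G) \<times> pverts (extended_double_cover G)"
    by (auto simp: extended_double_cover_def)
  ultimately have "finite (parcs (extended_double_cover G))"
    by (meson finite_SigmaI finite_subset)
  with fin show ?thesis
    by unfold_locales (auto simp: extended_double_cover_def symmetric_def intro!: symI)
qed

lemma pair_graph_iterated_double_cover:
  "pair_graph G \<Longrightarrow> pair_graph (iterated_double_cover k G)"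
  by (induction k) (auto intro: pair_graph_base_graph pair_graph_extended_double_cover)

lemma vertex_list:
  assumes "finite (pverts G)"
  shows "distinct (vertex_list G)" "set (vertex_list G) = pverts G"
proof -
  have "\<exists>vs. distinct vs \<and> set vs = pverts G"
    using finite_distinct_list[OF assms] by blast
  from someI_ex[OF this] show "distinct (vertex_list G)" "set (vertex_list G) = pverts G"
    by (auto simp: vertex_list_def)
qed

lemma char_poly_reindex:
  fixes f :: "'a \<Rightarrow> 'a \<Rightarrow> complex"
  assumes "distinct vs" "distinct ws" "set vs = set ws"
  shows "char_poly (mat (length vs) (length vs) (\<lambda>(i, j). f (vs ! i) (vs ! j))) =
         char_poly (mat (length ws) (length ws) (\<lambda>(i, j). f (ws ! i) (ws ! j)))"
proof -
  define n where "n = length vs"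
  have n: "length ws = n"
    using assms by (metis distinct_card n_def)
  define P where "P = mat n n (\<lambda>(i, j). if vs ! i = ws ! j then 1 else (0::complex))"
  define Q where "Q = mat n n (\<lambda>(i, j). if ws ! i = vs ! j then 1 else (0::complex))"
  define B where "B = mat n n (\<lambda>(i, j). f (ws ! i) (ws ! j))"
  have sumv: "(\<Sum>k<n. g (vs ! k)) = (\<Sum>v\<in>set vs. g v)" for g :: "'a \<Rightarrow> complex"
    using assms(1) by (simp add: n_def sum.distinct_set_conv_list sum_list_sum_nth atLeast0LessThan)
  have sumw: "(\<Sum>k<n. g (ws ! k)) = (\<Sum>v\<in>set vs. g v)" for g :: "'a \<Rightarrow> complex"
    using assms n by (simp add: sum.distinct_set_conv_list sum_list_sum_nth atLeast0LessThan)
  have mem: "i < n \<Longrightarrow> vs ! i \<in> set vs" "i < n \<Longrightarrow> ws ! i \<in> set vs" for i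
    using assms(3) n nth_mem[of i vs] nth_mem[of i ws] by (simp_all add: n_def)
  have inj: "i < n \<Longrightarrow> j < n \<Longrightarrow> vs ! i = vs ! j \<longleftrightarrow> i = j"
       "i < n \<Longrightarrow> j < n \<Longrightarrow> ws ! i = ws ! j \<longleftrightarrow> i = j" for i j
    using assms(1,2) n by (auto simp: n_def nth_eq_iff_index_eq)
  have PQ: "P * Q = 1\<^sub>m n"
  proof (rule eq_matI)
    fix i j assume "i < dim_row (1\<^sub>m n :: complex mat)" "j < dim_col (1\<^sub>m n :: complex mat)"
    then have ij: "i < n" "j < n" by auto
    have "(P * Q) $$ (i, j) =
        (\<Sum>k<n. (if vs ! i = ws ! k then 1 else 0) * (if ws ! k = vs ! j then 1 else 0))"
      using ij by (simp add: P_def Q_def scalar_prod_def atLeast0LessThan)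
    also have "\<dots> = (\<Sum>v\<in>set vs. (if vs ! i = v then 1 else 0) * (if v = vs ! j then 1 else 0))"
      by (rule sumw)
    also have "\<dots> = (\<Sum>v\<in>set vs. if v = vs ! i then (if v = vs ! j then 1 else 0) else 0)"
      by (intro sum.cong) auto
    also have "\<dots> = (if vs ! i = vs ! j then 1 else 0)"
      using mem ij by simp
    finally show "(P * Q) $$ (i, j) = 1\<^sub>m n $$ (i, j)"
      using ij inj by simp
  qed (auto simp: P_def Q_def)
  have QP: "Q * P = 1\<^sub>m n"
  proof (rule eq_matI)
    fix i j assume "i < dim_row (1\<^sub>m n :: complex mat)" "j < dim_col (1\<^sub>m n :: complex mat)"
    then have ij: "i < n" "j < n" by auto
    have "(Q * P) $$ (i, j) =
        (\<Sum>k<n. (if ws ! i = vs ! k then 1 else 0) * (if vs ! k = ws ! j then 1 else 0))"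
      using ij by (simp add: P_def Q_def scalar_prod_def atLeast0LessThan)
    also have "\<dots> = (\<Sum>v\<in>set vs. (if ws ! i = v then 1 else 0) * (if v = ws ! j then 1 else 0))"
      by (rule sumv)
    also have "\<dots> = (\<Sum>v\<in>set vs. if v = ws ! i then (if v = ws ! j then 1 else 0) else 0)"
      by (intro sum.cong) auto
    also have "\<dots> = (if ws ! i = ws ! j then 1 else 0)"
      using mem ij by simp
    finally show "(Q * P) $$ (i, j) = 1\<^sub>m n $$ (i, j)"
      using ij inj by simp
  qed (auto simp: P_def Q_def)
  have PB: "(P * B) $$ (i, j) = f (vs ! i) (ws ! j)" if ij: "i < n" "j < n" for i j
  proof -
    have "(P * B) $$ (i, j) = (\<Sum>k<n. (if vs ! i = ws ! k then 1 else 0) * f (ws ! k) (ws ! j))"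
      using ij by (simp add: P_def B_def scalar_prod_def atLeast0LessThan)
    also have "\<dots> = (\<Sum>v\<in>set vs. (if vs ! i = v then 1 else 0) * f v (ws ! j))"
      by (rule sumw)
    also have "\<dots> = (\<Sum>v\<in>set vs. if v = vs ! i then f v (ws ! j) else 0)"
      by (intro sum.cong) auto
    also have "\<dots> = f (vs ! i) (ws ! j)"
      using mem ij by simp
    finally show ?thesis .
  qed
  have PBQ: "P * B * Q = mat n n (\<lambda>(i, j). f (vs ! i) (vs ! j))"
  proof (rule eq_matI)
    fix i j
    assume "i < dim_row (mat n n (\<lambda>(i, j). f (vs ! i) (vs ! j)))"
      "j < dim_col (mat n n (\<lambda>(i, j). f (vs ! i) (vs ! j)))"
    then have ij: "i < n" "j < n" by auto
    have dims: "P * B \<in> carrier_mat n n" "Q \<in> carrier_mat n n"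
      by (auto simp: P_def B_def Q_def)
    have "(C * Q) $$ (i, j) = (\<Sum>k<n. C $$ (i, k) * Q $$ (k, j))"
      if "C \<in> carrier_mat n n" for C
      using that ij dims by (simp add: scalar_prod_def atLeast0LessThan)
    from this[OF dims(1)]
    have "(P * B * Q) $$ (i, j) = (\<Sum>k<n. (P * B) $$ (i, k) * Q $$ (k, j))" .
    also have "\<dots> = (\<Sum>k<n. f (vs ! i) (ws ! k) * (if ws ! k = vs ! j then 1 else 0))"
      using ij by (intro sum.cong refl) (simp add: PB Q_def del: index_mult_mat(1))
    also have "\<dots> = (\<Sum>v\<in>set vs. f (vs ! i) v * (if v = vs ! j then 1 else 0))"
      by (rule sumw)
    also have "\<dots> = (\<Sum>v\<in>set vs. if v = vs ! j then f (vs ! i) v else 0)"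
      by (intro sum.cong) auto
    also have "\<dots> = f (vs ! i) (vs ! j)"
      using mem ij by simp
    finally show "(P * B * Q) $$ (i, j) = mat n n (\<lambda>(i, j). f (vs ! i) (vs ! j)) $$ (i, j)"
      using ij by simp
  qed (auto simp: P_def Q_def)
  have "similar_mat (mat n n (\<lambda>(i, j). f (vs ! i) (vs ! j))) B"
    by (rule similar_matI[OF _ PQ QP PBQ[symmetric]]) (auto simp: P_def Q_def B_def)
  from char_poly_similar[OF this] show ?thesis
    by (simp add: B_def n n_def)
qed

lemma laplacian_mat_altdef:
  assumes "distinct vs"
  shows "laplacian_mat G vs = mat (length vs) (length vs) (\<lambda>(i, j).
    (\<lambda>u v. (if u = v then of_nat (out_degree (with_proj G) u) else 0) -
           (if (u, v) \<in> parcs G then 1 else 0)) (vs ! i) (vs ! j))"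
  using assms
  by (intro eq_matI)
    (auto simp: laplacian_mat_def degree_mat_def adjacency_mat_def mat_diag_def nth_eq_iff_index_eq)

lemma signless_laplacian_mat_altdef:
  assumes "distinct vs"
  shows "signless_laplacian_mat G vs = mat (length vs) (length vs) (\<lambda>(i, j).
    (\<lambda>u v. (if u = v then of_nat (out_degree (with_proj G) u) else 0) +
           (if (u, v) \<in> parcs G then 1 else 0)) (vs ! i) (vs ! j))"
  using assms
  by (intro eq_matI)
    (auto simp: signless_laplacian_mat_def degree_mat_def adjacency_mat_def mat_diag_def
      nth_eq_iff_index_eq)

lemma laplacian_spectrum_eq:
  assumes "distinct vs" "set vs = pverts G"
  shows "laplacian_spectrum G = eigenvalue_mset (laplacian_mat G vs)"
proof -
  have "finite (pverts G)" unfolding assms(2)[symmetric] by (rule List.finite_set)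
  note vl = vertex_list[OF this]
  show ?thesis
    unfolding laplacian_spectrum_def eigenvalue_mset_def
      laplacian_mat_altdef[OF assms(1)] laplacian_mat_altdef[OF vl(1)]
    by (subst char_poly_reindex[OF vl(1) assms(1)]) (use vl(2) assms(2) in auto)
qed

lemma signless_laplacian_spectrum_eq:
  assumes "distinct vs" "set vs = pverts G"
  shows "signless_laplacian_spectrum G = eigenvalue_mset (signless_laplacian_mat G vs)"
proof -
  have "finite (pverts G)" unfolding assms(2)[symmetric] by (rule List.finite_set)
  note vl = vertex_list[OF this]
  show ?thesis
    unfolding signless_laplacian_spectrum_def eigenvalue_mset_def
      signless_laplacian_mat_altdef[OF assms(1)] signless_laplacian_mat_altdef[OF vl(1)]
    by (subst char_poly_reindex[OF vl(1) assms(1)]) (use vl(2) assms(2) in auto)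
qed

end

theory Submission
  imports Defs
begin

text \<open>
  Let \<open>A\<close> and \<open>D\<close> be the adjacency and degree matrices of a graph \<open>G\<close>, and put \<open>B = D + I\<close> and
  \<open>C = A + I\<close>. If the two copies of the vertex set are listed one after the other, the extended
  double cover has the degree matrix \<open>diag(B, B)\<close> and the adjacency matrix with \<open>C\<close> in both
  off-diagonal blocks. Both of its Laplacians therefore have \<open>B\<close> twice on the diagonal and the
  same matrix, \<open>-C\<close> or \<open>C\<close>, twice off the diagonal. The spectrum of such a block matrix is the
  union of the spectra of the sum and the difference of its two blocks. Here these are
  \<open>B - C = D - A\<close>, the Laplacian of \<open>G\<close>, and \<open>B + C = (D + A) + 2I\<close>, the signless Laplacian of
  \<open>G\<close> shifted by \<open>2\<close>. The sign of the off-diagonal block only exchanges the two, so the Laplacian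
  and the signless Laplacian spectra of a double cover coincide
  (\<open>spectra_extended_double_cover\<close>), as for every bipartite graph.

  From the first cover on, the common spectrum \<open>M\<close> thus evolves by \<open>M \<mapsto> M + (M shifted by 2)\<close>.
  Iterating this \<open>k - 1\<close> times produces \<open>(k - 1) choose r\<close> copies of the first spectrum shifted
  by \<open>2 * r\<close>, for each \<open>r\<close> (\<open>iterated_shift_mset\<close>). Since the first spectrum consists of all \<open>\<mu>\<^sub>i\<close>
  and all \<open>\<mu>\<^sub>i\<^sup>+ + 2\<close>, the claim is a reindexing of this sum: the extra \<open>2\<close> turns the
  coefficient of \<open>\<mu>\<^sub>i\<^sup>+ + 2 * r\<close> into \<open>(k - 1) choose (r - 1)\<close>.
\<close>

section \<open>Block matrices with two repeated blocks\<close>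

text \<open>
  Subtracting the second block column from the first and then adding the first block row to the
  second makes the matrix block upper triangular. Both operations have determinant \<open>1\<close>, and
  no division is involved, so the identity holds over any integral domain; this allows its use
  with polynomial entries below.
\<close>

lemma det_four_block_mat_swap_symmetric:
  fixes P Q :: "'a :: idom mat"
  assumes P: "P \<in> carrier_mat n n" and Q: "Q \<in> carrier_mat n n"
  shows "det (four_block_mat P Q Q P) = det (P + Q) * det (P - Q)"
proof -
  define S where "S = four_block_mat (1\<^sub>m n) (0\<^sub>m n n) (1\<^sub>m n) (1\<^sub>m n :: 'a mat)"
  define T where "T = four_block_mat (1\<^sub>m n) (0\<^sub>m n n) (- 1\<^sub>m n) (1\<^sub>m n :: 'a mat)"
  let ?M = "four_block_mat P Q Q P"
  have dets: "det S = 1" "det T = 1"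
    unfolding S_def T_def
    by (subst det_four_block_mat_upper_right_zero[of _ n _ n]; simp)+
  have car: "S \<in> carrier_mat (n + n) (n + n)" "T \<in> carrier_mat (n + n) (n + n)"
    "?M \<in> carrier_mat (n + n) (n + n)"
    using P Q by (simp_all add: S_def T_def)
  have neg: "Q * - 1\<^sub>m n = - Q" "P * - 1\<^sub>m n = - P"
    using P Q by auto
  have MT: "?M * T = four_block_mat (P - Q) Q (Q - P) P"
    unfolding T_def
    by (subst mult_four_block_mat[of _ n n _ n _ n])
      (use P Q neg in \<open>auto intro!: cong_four_block_mat\<close>)
  have "S * (?M * T) = four_block_mat (P - Q) Q (0\<^sub>m n n) (P + Q)"
    unfolding MT S_def
    by (subst mult_four_block_mat[of _ n n _ n _ n])
      (use P Q in \<open>auto intro!: cong_four_block_mat eq_matI\<close>)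
  then have "det (S * (?M * T)) = det (P - Q) * det (P + Q)"
    using P Q by (simp add: det_four_block_mat_lower_left_zero[OF minus_carrier_mat])
  moreover have "det (S * (?M * T)) = det ?M"
    using car dets by (simp add: det_mult[of _ "n + n"])
  ultimately show ?thesis by (simp add: mult.commute)
qed

text \<open>
  The matrix \<open>x I - M\<close> inherits the block pattern of \<open>M\<close>, with blocks \<open>x I - B\<close> and \<open>- C\<close>.
\<close>

lemma char_poly_four_block_mat_swap_symmetric:
  fixes B C :: "'a :: idom mat"
  assumes B: "B \<in> carrier_mat n n" and C: "C \<in> carrier_mat n n"
  shows "char_poly (four_block_mat B C C B) = char_poly (B + C) * char_poly (B - C)"
proof -
  let ?N = "map_mat (\<lambda>a. [:- a:]) C"
  have "char_poly_matrix (four_block_mat B C C B) =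
      four_block_mat (char_poly_matrix B) ?N ?N (char_poly_matrix B)"
    using B C by (intro eq_matI) (auto simp: char_poly_matrix_def)
  moreover have "char_poly_matrix B + ?N = char_poly_matrix (B + C)"
    "char_poly_matrix B - ?N = char_poly_matrix (B - C)"
    using B C by (auto simp: char_poly_matrix_def intro!: eq_matI)
  ultimately show ?thesis
    using B C by (simp add: char_poly_def det_four_block_mat_swap_symmetric[of _ n])
qed

lemma char_poly_ne_0:
  fixes A :: "'a :: comm_ring_1 mat"
  assumes "A \<in> carrier_mat n n"
  shows "char_poly A \<noteq> 0"
  using degree_monic_char_poly[OF assms] by auto

lemma eigenvalue_mset_four_block_mat_swap_symmetric:
  assumes "B \<in> carrier_mat n n" "C \<in> carrier_mat n n"
  shows "eigenvalue_mset (four_block_mat B C C B) =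
    eigenvalue_mset (B + C) + eigenvalue_mset (B - C)"
proof -
  have "char_poly (B + C) \<noteq> 0" "char_poly (B - C) \<noteq> 0"
    using assms by (auto intro!: char_poly_ne_0[of _ n])
  then show ?thesis
    using assms
    by (simp add: eigenvalue_mset_def char_poly_four_block_mat_swap_symmetric[of _ n] proots_mult)
qed

section \<open>Shifting a matrix by a multiple of the identity\<close>

text \<open>
  Substituting \<open>x - c\<close> for \<open>x\<close> is a ring homomorphism on polynomials and therefore commutes with
  the determinant.
\<close>

lemma char_poly_add_scalar_mat:
  fixes A :: "'a :: idom mat"
  assumes "A \<in> carrier_mat n n"
  shows "char_poly (A + c \<cdot>\<^sub>m 1\<^sub>m n) = char_poly A \<circ>\<^sub>p [:- c, 1:]"
proof -
  have hom: "comm_ring_hom (\<lambda>p :: 'a poly. p \<circ>\<^sub>p [:- c, 1:])"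
    by unfold_locales (simp_all add: pcompose_add pcompose_mult pcompose_1)
  have "char_poly_matrix (A + c \<cdot>\<^sub>m 1\<^sub>m n) = map_mat (\<lambda>p. p \<circ>\<^sub>p [:- c, 1:]) (char_poly_matrix A)"
    using assms
    by (intro eq_matI) (auto simp: char_poly_matrix_def pcompose_pCons pcompose_add)
  then show ?thesis
    by (simp add: char_poly_def comm_ring_hom.hom_det[OF hom])
qed

lemma eigenvalue_mset_add_scalar_mat:
  assumes "A \<in> carrier_mat n n"
  shows "eigenvalue_mset (A + c \<cdot>\<^sub>m 1\<^sub>m n) = image_mset (\<lambda>x. x + c) (eigenvalue_mset A)"
proof -
  obtain as where as: "char_poly A = (\<Prod>a\<leftarrow>as. [:- a, 1:])"
    using char_poly_factorized[OF assms] by blast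
  have roots: "proots (\<Prod>a\<leftarrow>bs. [:- a, 1:]) = mset bs" for bs :: "complex list"
  proof (induction bs)
    case (Cons b bs)
    have "(\<Prod>a\<leftarrow>bs. [:- a, 1:]) \<noteq> 0"
      by (auto simp: prod_list_zero_iff)
    then have "proots ([:- b, 1:] * (\<Prod>a\<leftarrow>bs. [:- a, 1:])) = {#b#} + mset bs"
      by (subst proots_mult) (simp_all add: Cons del: mult_pCons_left)
    then show ?case by (simp del: mult_pCons_left)
  qed simp
  have "(\<Prod>a\<leftarrow>bs. [:- a, 1:]) \<circ>\<^sub>p [:- c, 1:] = (\<Prod>a\<leftarrow>map (\<lambda>x. x + c) bs. [:- a, 1:])"
    for bs :: "complex list"
    by (induction bs)
      (simp_all add: pcompose_mult pcompose_pCons pcompose_1 del: mult_pCons_left)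
  then show ?thesis
    by (simp add: eigenvalue_mset_def char_poly_add_scalar_mat[OF assms] as roots
        del: map_map)
qed

section \<open>The matrices of the extended double cover\<close>

lemma laplacian_mat_carrier [simp]: "laplacian_mat G vs \<in> carrier_mat (length vs) (length vs)"
  and signless_laplacian_mat_carrier [simp]:
    "signless_laplacian_mat G vs \<in> carrier_mat (length vs) (length vs)"
  by (auto simp: laplacian_mat_def signless_laplacian_mat_def degree_mat_def adjacency_mat_def)

text \<open>
  A copy of \<open>u\<close> is joined to the opposite copies of the closed neighbourhood of \<open>u\<close>; as there are
  no loops, this has one element more than the neighbourhood.
\<close>

lemma out_degree_extended_double_cover:
  assumes "pair_graph G" "u \<in> pverts G"
  shows "out_degree (with_proj (extended_double_cover G)) (X_copy u) =
      Suc (out_degree (with_proj G) u)"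
    and "out_degree (with_proj (extended_double_cover G)) (Y_copy u) =
      Suc (out_degree (with_proj G) u)"
proof -
  interpret pair_graph G by fact
  define N where "N = {v \<in> pverts G. u = v \<or> (u, v) \<in> parcs G}"
  have loop: "(u, u) \<notin> parcs G"
    using no_loops' by blast
  have arcs: "out_arcs (with_proj G) u = Pair u ` (N - {u})"
    using in_arcsD2 loop by (auto simp: out_arcs_def N_def)
  have N: "finite N" "u \<in> N"
    using pair_finite_verts assms(2) by (auto simp: N_def)
  have card: "card N = Suc (out_degree (with_proj G) u)"
    by (simp add: out_degree_def arcs card_image inj_on_def card.remove[OF N])
  have "out_arcs (with_proj (extended_double_cover G)) (X_copy u) =
      (\<lambda>v. (X_copy u, Y_copy v)) ` N"
    using assms(2) by (auto simp: out_arcs_def extended_double_cover_def N_def)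
  then show "out_degree (with_proj (extended_double_cover G)) (X_copy u) =
      Suc (out_degree (with_proj G) u)"
    using card by (simp add: out_degree_def card_image inj_on_def)
  have "out_arcs (with_proj (extended_double_cover G)) (Y_copy u) =
      (\<lambda>v. (Y_copy u, X_copy v)) ` N"
    using assms(2) arcs_symmetric
    by (auto simp: out_arcs_def extended_double_cover_def N_def)
  then show "out_degree (with_proj (extended_double_cover G)) (Y_copy u) =
      Suc (out_degree (with_proj G) u)"
    using card by (simp add: out_degree_def card_image inj_on_def)
qed

lemma adjacency_mat_extended_double_cover:
  assumes "pair_graph G" "distinct vs" "set vs = pverts G"
  defines "C \<equiv> adjacency_mat G vs + 1\<^sub>m (length vs)"
  shows "adjacency_mat (extended_double_cover G) (map X_copy vs @ map Y_copy vs) =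
    four_block_mat (0\<^sub>m (length vs) (length vs)) C C (0\<^sub>m (length vs) (length vs))"
proof -
  interpret pair_graph G by fact
  have sym: "(v, w) \<in> parcs G \<longleftrightarrow> (w, v) \<in> parcs G" for v w
    using arcs_symmetric by blast
  have loop: "(v, v) \<notin> parcs G" for v
    using no_loops' by blast
  have mem: "vs ! i \<in> pverts G" if "i < length vs" for i
    using that assms(3) nth_mem by blast
  have eq: "vs ! i = vs ! j \<longleftrightarrow> i = j" if "i < length vs" "j < length vs" for i j
    using that assms(2) by (simp add: nth_eq_iff_index_eq)
  show ?thesis
  proof (rule eq_matI)
    fix i j
    let ?n = "length vs"
    assume "i < dim_row (four_block_mat (0\<^sub>m ?n ?n) C C (0\<^sub>m ?n ?n))"
      "j < dim_col (four_block_mat (0\<^sub>m ?n ?n) C C (0\<^sub>m ?n ?n))"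
    then have "i < ?n + ?n" "j < ?n + ?n"
      by (simp_all add: C_def)
    then show "adjacency_mat (extended_double_cover G) (map X_copy vs @ map Y_copy vs) $$ (i, j) =
        four_block_mat (0\<^sub>m ?n ?n) C C (0\<^sub>m ?n ?n) $$ (i, j)"
      by (cases "i < ?n"; cases "j < ?n")
        (simp_all add: C_def adjacency_mat_def nth_append extended_double_cover_def mem loop eq
          sym[of "vs ! (i - ?n)"])
  qed (simp_all add: C_def adjacency_mat_def)
qed

lemma degree_mat_extended_double_cover:
  assumes "pair_graph G" "distinct vs" "set vs = pverts G"
  defines "B \<equiv> degree_mat G vs + 1\<^sub>m (length vs)"
  shows "degree_mat (extended_double_cover G) (map X_copy vs @ map Y_copy vs) =
    four_block_mat B (0\<^sub>m (length vs) (length vs)) (0\<^sub>m (length vs) (length vs)) B"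
proof -
  have mem: "vs ! i \<in> pverts G" if "i < length vs" for i
    using that assms(3) nth_mem by blast
  show ?thesis
    by (rule eq_matI)
      (auto simp: B_def degree_mat_def mat_diag_def nth_append mem
        out_degree_extended_double_cover[OF assms(1)])
qed

section \<open>Spectra of the covers\<close>

text \<open>
  The identity matrices added to \<open>D\<close> and \<open>A\<close> cancel in \<open>B - C\<close> and add up to \<open>2 I\<close> in \<open>B + C\<close>;
  this is the origin of the shift.
\<close>

lemma spectra_extended_double_cover:
  assumes "pair_graph G"
  defines "M \<equiv> laplacian_spectrum G + image_mset (\<lambda>x. x + 2) (signless_laplacian_spectrum G)"
  shows "laplacian_spectrum (extended_double_cover G) = M"
    and "signless_laplacian_spectrum (extended_double_cover G) = M"
proof -
  interpret pair_graph G by fact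
  define vs where "vs = vertex_list G"
  have vs: "distinct vs" "set vs = pverts G"
    using vertex_list[OF pair_finite_verts] by (auto simp: vs_def)
  define n where "n = length vs"
  define ws where "ws = map X_copy vs @ map Y_copy vs"
  have ws: "distinct ws" "set ws = pverts (extended_double_cover G)"
    using vs by (auto simp: ws_def distinct_map inj_on_def extended_double_cover_def)
  define B where "B = degree_mat G vs + 1\<^sub>m n"
  define C where "C = adjacency_mat G vs + 1\<^sub>m n"
  have AD: "degree_mat G vs \<in> carrier_mat n n" "adjacency_mat G vs \<in> carrier_mat n n"
    by (auto simp: degree_mat_def adjacency_mat_def n_def)
  then have BC: "B \<in> carrier_mat n n" "C \<in> carrier_mat n n" "- C \<in> carrier_mat n n"
    by (auto simp: B_def C_def)
  have sum: "B + C = signless_laplacian_mat G vs + 2 \<cdot>\<^sub>m 1\<^sub>m n" "B - - C = B + C"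
    and diff: "B - C = laplacian_mat G vs" "B + - C = B - C"
    using AD by (auto simp: B_def C_def laplacian_mat_def signless_laplacian_mat_def intro!: eq_matI)
  have M: "M = eigenvalue_mset (B - C) + eigenvalue_mset (B + C)"
    unfolding M_def sum diff laplacian_spectrum_eq[OF vs] signless_laplacian_spectrum_eq[OF vs]
    by (simp add: eigenvalue_mset_add_scalar_mat n_def)
  have "laplacian_mat (extended_double_cover G) ws = four_block_mat B (- C) (- C) B"
    using BC vs assms(1)
    by (auto simp: laplacian_mat_def ws_def degree_mat_extended_double_cover
        adjacency_mat_extended_double_cover B_def[symmetric] C_def[symmetric] n_def[symmetric]
        intro!: eq_matI)
  then show "laplacian_spectrum (extended_double_cover G) = M"
    unfolding laplacian_spectrum_eq[OF ws] M
    using BC by (simp add: eigenvalue_mset_four_block_mat_swap_symmetric[of _ n] sum diff)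
  have "signless_laplacian_mat (extended_double_cover G) ws = four_block_mat B C C B"
    using BC vs assms(1)
    by (auto simp: signless_laplacian_mat_def ws_def degree_mat_extended_double_cover
        adjacency_mat_extended_double_cover B_def[symmetric] C_def[symmetric] n_def[symmetric]
        intro!: eq_matI)
  then show "signless_laplacian_spectrum (extended_double_cover G) = M"
    unfolding signless_laplacian_spectrum_eq[OF ws] M
    using BC by (simp add: eigenvalue_mset_four_block_mat_swap_symmetric[of _ n])
qed

lemma spectra_base_graph:
  assumes "pair_graph G"
  shows "laplacian_spectrum (base_graph G) = laplacian_spectrum G"
    and "signless_laplacian_spectrum (base_graph G) = signless_laplacian_spectrum G"
proof -
  interpret pair_graph G by fact
  define vs where "vs = vertex_list G"
  have vs: "distinct vs" "set vs = pverts G"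
    using vertex_list[OF pair_finite_verts] by (auto simp: vs_def)
  have ws: "distinct (map Base vs)" "set (map Base vs) = pverts (base_graph G)"
    using vs by (auto simp: distinct_map inj_on_def base_graph_def)
  have "out_arcs (with_proj (base_graph G)) (Base u) = map_prod Base Base ` out_arcs (with_proj G) u"
    for u
    by (force simp: out_arcs_def base_graph_def)
  then have deg: "out_degree (with_proj (base_graph G)) (Base u) = out_degree (with_proj G) u" for u
    by (auto simp: out_degree_def inj_on_def intro!: card_image)
  have arc: "(Base u, Base v) \<in> parcs (base_graph G) \<longleftrightarrow> (u, v) \<in> parcs G" for u v
    by (force simp: base_graph_def)
  have mats: "degree_mat (base_graph G) (map Base vs) = degree_mat G vs"
    "adjacency_mat (base_graph G) (map Base vs) = adjacency_mat G vs"
    by (auto simp: degree_mat_def adjacency_mat_def mat_diag_def deg arc intro!: eq_matI)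
  show "laplacian_spectrum (base_graph G) = laplacian_spectrum G"
    unfolding laplacian_spectrum_eq[OF vs] laplacian_spectrum_eq[OF ws]
    by (simp add: laplacian_mat_def mats)
  show "signless_laplacian_spectrum (base_graph G) = signless_laplacian_spectrum G"
    unfolding signless_laplacian_spectrum_eq[OF vs] signless_laplacian_spectrum_eq[OF ws]
    by (simp add: signless_laplacian_mat_def mats)
qed

section \<open>Iterated translation of multisets\<close>

lemma image_mset_repeat_mset: "image_mset f (repeat_mset c M) = repeat_mset c (image_mset f M)"
  by (induction c) auto

lemma repeat_image_mset_set:
  "repeat_mset c {# f i. i \<in># mset_set A #} = (\<Sum>i\<in>A. replicate_mset c (f i))"
  by (induction A rule: infinite_finite_induct) (auto simp: repeat_mset_replicate_mset)

text \<open>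
  This is the binomial theorem for the operator \<open>1 + T\<close>, where \<open>T\<close> translates multisets by \<open>c\<close>;
  the induction step is Pascal's rule.
\<close>

lemma iterated_shift_mset:
  fixes M :: "nat \<Rightarrow> 'a :: comm_semiring_1 multiset"
  assumes step: "\<And>k. M (Suc k) = M k + image_mset (\<lambda>x. x + c) (M k)"
  shows "M k = (\<Sum>r\<le>k. repeat_mset (k choose r) (image_mset (\<lambda>x. x + c * of_nat r) (M 0)))"
proof (induction k)
  case (Suc k)
  define S where "S = (\<lambda>r. image_mset (\<lambda>x. x + c * of_nat r) (M 0))"
  have S: "image_mset (\<lambda>x. x + c) (S r) = S (Suc r)" for r
    by (simp add: S_def image_mset.compositionality o_def algebra_simps)
  have IH: "M k = (\<Sum>r\<le>k. repeat_mset (k choose r) (S r))"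
    using Suc by (simp add: S_def)
  have shift: "image_mset (\<lambda>x. x + c) (\<Sum>r\<in>A. repeat_mset (k choose r) (S r)) =
      (\<Sum>r\<in>A. repeat_mset (k choose r) (S (Suc r)))" for A
    by (induction A rule: infinite_finite_induct) (simp_all add: image_mset_repeat_mset S)
  have "(\<Sum>r\<le>Suc k. repeat_mset (Suc k choose r) (S r)) =
      S 0 + (\<Sum>r\<le>k. repeat_mset (k choose Suc r) (S (Suc r))) +
      (\<Sum>r\<le>k. repeat_mset (k choose r) (S (Suc r)))"
    by (subst sum.atMost_Suc_shift) (simp add: left_add_mult_distrib_mset sum.distrib)
  also have "S 0 + (\<Sum>r\<le>k. repeat_mset (k choose Suc r) (S (Suc r))) =
      (\<Sum>r\<le>Suc k. repeat_mset (k choose r) (S r))"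
    by (subst sum.atMost_Suc_shift) simp
  also have "\<dots> = M k"
    by (simp add: IH binomial_eq_0)
  also have "(\<Sum>r\<le>k. repeat_mset (k choose r) (S (Suc r))) = image_mset (\<lambda>x. x + c) (M k)"
    unfolding IH shift by (rule refl)
  also have "M k + image_mset (\<lambda>x. x + c) (M k) = M (Suc k)"
    by (rule step[symmetric])
  finally show ?case
    by (simp only: S_def)
qed simp

section \<open>The spectrum of the iterated cover\<close>

theorem theorem3p3:
  fixes G :: "'a pair_pre_digraph" and n m k :: nat and \<mu> \<mu>' :: "nat \<Rightarrow> complex"
  assumes "pair_graph G"
    and "card (pverts G) = n" and "card (edges G) = m"
    and "laplacian_spectrum G = {# \<mu> i. i \<in># mset_set {1..n} #}"
    and "signless_laplacian_spectrum G = {# \<mu>' i. i \<in># mset_set {1..n} #}"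
    and "k \<ge> 1"
  shows "laplacian_spectrum (iterated_double_cover k G) =
    (\<Sum>i = 1..n.
        replicate_mset (k choose 0) (\<mu> i)
      + (\<Sum>r = 1..k - 1.
            replicate_mset ((k - 1) choose r) (\<mu> i + 2 * of_nat r)
          + replicate_mset ((k - 1) choose (r - 1)) (\<mu>' i + 2 * of_nat r))
      + replicate_mset (k choose k) (\<mu>' i + 2 * of_nat k))"
proof -
  \<comment> \<open>The sequence starts at the first cover: the two spectra of \<open>G\<close> itself may differ.\<close>
  define M where "M = (\<lambda>j. laplacian_spectrum (iterated_double_cover (Suc j) G))"
  obtain l where k: "k = Suc l"
    using \<open>k \<ge> 1\<close> by (cases k) auto
  note graph = pair_graph_iterated_double_cover[OF \<open>pair_graph G\<close>]
  have "M (Suc j) = M j + image_mset (\<lambda>x. x + 2) (M j)" for j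
    using spectra_extended_double_cover[OF graph[of "Suc j"]]
      spectra_extended_double_cover[OF graph[of j]]
    by (simp add: M_def)
  from iterated_shift_mset[of M, OF this, of l]
  have "M l = (\<Sum>r\<le>l. repeat_mset (l choose r) (image_mset (\<lambda>x. x + 2 * of_nat r) (M 0)))" .
  also have "M 0 = {# \<mu> i. i \<in># mset_set {1..n} #} + {# \<mu>' i + 2. i \<in># mset_set {1..n} #}"
    using spectra_extended_double_cover[OF graph[of 0]] spectra_base_graph[OF \<open>pair_graph G\<close>]
      assms(4,5)
    by (simp add: M_def image_mset.compositionality o_def)
  also have "(\<Sum>r\<le>l. repeat_mset (l choose r) (image_mset (\<lambda>x. x + 2 * of_nat r) \<dots>)) =
      (\<Sum>r\<le>l. \<Sum>i = 1..n. replicate_mset (l choose r) (\<mu> i + 2 * of_nat r)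
        + replicate_mset (l choose r) (\<mu>' i + 2 * of_nat (Suc r)))"
    by (simp add: image_mset.compositionality o_def repeat_image_mset_set sum.distrib algebra_simps)
  also have "\<dots> = (\<Sum>i = 1..n. (\<Sum>r\<le>l. replicate_mset (l choose r) (\<mu> i + 2 * of_nat r))
        + (\<Sum>r\<le>l. replicate_mset (l choose r) (\<mu>' i + 2 * of_nat (Suc r))))"
    by (subst sum.swap) (simp add: sum.distrib)
  also have "\<dots> = (\<Sum>i = 1..n.
        replicate_mset (k choose 0) (\<mu> i)
      + (\<Sum>r = 1..k - 1.
            replicate_mset ((k - 1) choose r) (\<mu> i + 2 * of_nat r)
          + replicate_mset ((k - 1) choose (r - 1)) (\<mu>' i + 2 * of_nat r))
      + replicate_mset (k choose k) (\<mu>' i + 2 * of_nat k))"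
  proof (rule sum.cong[OF refl])
    fix i
    \<comment> \<open>The term \<open>\<mu> i\<close> comes from \<open>r = 0\<close> here, and \<open>\<mu>' i + 2 * k\<close> from \<open>r = l\<close> below.\<close>
    have 1: "(\<Sum>r\<le>l. replicate_mset (l choose r) (\<mu> i + 2 * of_nat r)) =
        {#\<mu> i#} + (\<Sum>r = 1..l. replicate_mset (l choose r) (\<mu> i + 2 * of_nat r))"
      by (simp add: sum.atLeast_Suc_atMost atMost_atLeast0)
    have "(\<Sum>r\<le>l. replicate_mset (l choose r) (\<mu>' i + 2 * of_nat (Suc r))) =
        (\<Sum>r = 1..Suc l. replicate_mset (l choose (r - 1)) (\<mu>' i + 2 * of_nat r))"
      by (simp add: sum.shift_bounds_cl_Suc_ivl atMost_atLeast0 del: of_nat_Suc sum.cl_ivl_Suc)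
    then have 2: "(\<Sum>r\<le>l. replicate_mset (l choose r) (\<mu>' i + 2 * of_nat (Suc r))) =
        (\<Sum>r = 1..l. replicate_mset (l choose (r - 1)) (\<mu>' i + 2 * of_nat r)) +
        {#\<mu>' i + 2 * of_nat k#}"
      by (simp add: k)
    show "(\<Sum>r\<le>l. replicate_mset (l choose r) (\<mu> i + 2 * of_nat r)) +
        (\<Sum>r\<le>l. replicate_mset (l choose r) (\<mu>' i + 2 * of_nat (Suc r))) =
        replicate_mset (k choose 0) (\<mu> i)
      + (\<Sum>r = 1..k - 1.
            replicate_mset ((k - 1) choose r) (\<mu> i + 2 * of_nat r)
          + replicate_mset ((k - 1) choose (r - 1)) (\<mu>' i + 2 * of_nat r))
      + replicate_mset (k choose k) (\<mu>' i + 2 * of_nat k)"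
      unfolding 1 2 by (simp add: k sum.distrib)
  qed
  finally show ?thesis
    unfolding M_def k[symmetric] .
qed

end
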